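(* Let $I=J(G)$ be the cover ideal of a graph $G$ with $n$ vertices. Then $$\hat{\alpha}(I)=\frac{\alpha(I^{(2)})}{2}.$$
   Context: Let $\mathbb{K}$ be a field. For a finite simple graph $G$ with vertex set $\{x_1,\dots,x_n\}$ and edge set $E$, the cover ideal is $J(G)=\bigcap_{\{x_i,x_j\}\in E}(x_i,x_j)\subseteq R=\mathbb{K}[x_1,\dots,x_n]$; its $m$-th symbolic power is $J(G)^{(m)}=\bigcap_{\{x_i,x_j\}\in E}(x_i,x_j)^m$. For a nonzero homogeneous ideal $L$ of $R$ (standard grading), $\alpha(L)=\min\{\deg f\mid f\in L, f\ne 0\}$. The Waldschmidt constant is $\hat{\alpha}(I)=\lim_{m\to\infty}\frac{\alpha(I^{(m)})}{m}$. *)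

theory Defs
  imports Complex_Main "HOL-Library.Poly_Mapping"
begin

text \<open>The polynomial ring \<open>R = K[x\<^sub>v : v]\<close> with one indeterminate for each element of the
  finite type \<open>'v\<close>: finitely supported functions from exponent vectors to coefficients, with
  convolution as multiplication.\<close>

type_synonym ('v, 'k) mpoly = "('v \<Rightarrow>\<^sub>0 nat) \<Rightarrow>\<^sub>0 'k"

definition var :: "'v \<Rightarrow> ('v, 'k::field) mpoly" where
  "var v = Poly_Mapping.single (Poly_Mapping.single v 1) 1"

text \<open>Total degree. As \<open>Max {}\<close> is unspecified, this is meaningful only for \<open>f \<noteq> 0\<close>.\<close>

definition total_degree :: "('v::finite, 'k::field) mpoly \<Rightarrow> nat" where
  "total_degree f = Max ((\<lambda>t. \<Sum>v\<in>UNIV. Poly_Mapping.lookup t v) ` Poly_Mapping.keys f)"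

text \<open>Ideals of a commutative ring are its submodules as a module over itself.\<close>

definition gen_ideal :: "'a::comm_ring_1 set \<Rightarrow> 'a set" where
  "gen_ideal B = module.span (*) B"

definition ideal_mult :: "'a::comm_ring_1 set \<Rightarrow> 'a set \<Rightarrow> 'a set" where
  "ideal_mult A B = gen_ideal {a * b | a b. a \<in> A \<and> b \<in> B}"

primrec ideal_power :: "'a::comm_ring_1 set \<Rightarrow> nat \<Rightarrow> 'a set" where
  "ideal_power A 0 = UNIV"
| "ideal_power A (Suc m) = ideal_mult A (ideal_power A m)"

text \<open>A finite simple graph with vertex set \<open>UNIV :: 'v set\<close> is given by its set of edges.\<close>

definition simple_graph :: "'v::finite set set \<Rightarrow> bool" where
  "simple_graph E \<longleftrightarrow> (\<forall>e\<in>E. card e = 2)"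

text \<open>For an edge \<open>e = {i, j}\<close>, \<open>gen_ideal (var ` e)\<close> is the ideal \<open>(x\<^sub>i, x\<^sub>j)\<close>. If there are no edges,
  the intersections below are the unit ideal.\<close>

definition cover_ideal :: "'v::finite set set \<Rightarrow> ('v, 'k::field) mpoly set" where
  "cover_ideal E = (\<Inter>e\<in>E. gen_ideal (var ` e))"

definition cover_ideal_symbolic_power ::
  "'v::finite set set \<Rightarrow> nat \<Rightarrow> ('v, 'k::field) mpoly set" where
  "cover_ideal_symbolic_power E m = (\<Inter>e\<in>E. ideal_power (gen_ideal (var ` e)) m)"

definition initial_degree :: "('v::finite, 'k::field) mpoly set \<Rightarrow> nat" where
  "initial_degree L = (LEAST d. \<exists>f\<in>L. f \<noteq> 0 \<and> d = total_degree f)"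

text \<open>The argument is the family \<open>m \<mapsto> I\<^sup>(\<^sup>m\<^sup>)\<close> of symbolic powers of the ideal \<open>I\<close>. The value is
  meaningful only if the limit exists.\<close>

definition waldschmidt_constant :: "(nat \<Rightarrow> ('v::finite, 'k::field) mpoly set) \<Rightarrow> real" where
  "waldschmidt_constant S = lim (\<lambda>m. real (initial_degree (S m)) / real m)"

lemma module_mult: "module ((*) :: 'a::comm_ring_1 \<Rightarrow> 'a \<Rightarrow> 'a)"
  by unfold_locales (simp_all add: algebra_simps)

lemma ideal_power_1: "ideal_power (gen_ideal B) 1 = gen_ideal B"
proof -
  interpret module "(*) :: 'a \<Rightarrow> 'a \<Rightarrow> 'a" by (rule module_mult)
  have "{a * b | a b. a \<in> span B \<and> b \<in> (UNIV :: 'a set)} = span B"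
  proof
    show "{a * b | a b. a \<in> span B \<and> b \<in> (UNIV :: 'a set)} \<subseteq> span B"
      using span_scale by (fastforce simp: mult.commute)
    show "span B \<subseteq> {a * b | a b. a \<in> span B \<and> b \<in> (UNIV :: 'a set)}"
      using mult.right_neutral by (metis (mono_tags, lifting) UNIV_I mem_Collect_eq subsetI)
  qed
  then show ?thesis by (simp add: ideal_mult_def gen_ideal_def span_span)
qed

lemma cover_ideal_symbolic_power_1: "cover_ideal_symbolic_power E 1 = cover_ideal E"
  unfolding cover_ideal_symbolic_power_def cover_ideal_def ideal_power_1 ..

end

theory Submission
  imports Defs
begin

text \<open>
  The symbolic powers of a cover ideal are monomial ideals: a polynomial lies in \<open>(x\<^sub>i, x\<^sub>j)\<^sup>m\<close> iff
  each of its exponent vectors \<open>t\<close> satisfies \<open>t\<^sub>i + t\<^sub>j \<ge> m\<close>. Hence \<open>\<alpha>(I\<^sup>(\<^sup>m\<^sup>))\<close> is the least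
  total weight of an \<open>m\<close>-cover, a weighting of the vertices by natural numbers that gives every
  edge weight at least \<open>m\<close> (\<open>initial_degree_le_k_cover\<close> and \<open>ex_k_cover_initial_degree\<close>).

  After division by \<open>m\<close>, minimal \<open>m\<close>-covers are approximations of the fractional vertex cover
  linear program, and that program is half-integral. Half-integrality is obtained by threshold
  rounding: for an \<open>m\<close>-cover \<open>t\<close> and a threshold \<open>\<theta> \<in> {1..m}\<close>, give a vertex \<open>v\<close> one unit if
  \<open>2 t\<^sub>v \<ge> \<theta>\<close> and one more unit if \<open>2 t\<^sub>v \<ge> 2 m + 1 - \<theta>\<close>. This is a \<open>2\<close>-cover for every \<open>\<theta>\<close>,
  and since the numbers \<open>\<theta>\<close> and \<open>2 m + 1 - \<theta>\<close> run once through \<open>{1..2m}\<close>, the \<open>m\<close> rounded covers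
  together give \<open>v\<close> weight at most \<open>2 t\<^sub>v\<close>. Therefore \<open>m \<alpha>(I\<^sup>(\<^sup>2\<^sup>)) \<le> 2 \<alpha>(I\<^sup>(\<^sup>m\<^sup>))\<close>. In the other
  direction, \<open>\<lceil>m/2\<rceil>\<close> times a minimal \<open>2\<close>-cover is an \<open>m\<close>-cover, so that
  \<open>2 \<alpha>(I\<^sup>(\<^sup>m\<^sup>)) \<le> (m + 1) \<alpha>(I\<^sup>(\<^sup>2\<^sup>))\<close>. Dividing both bounds by \<open>2 m\<close> squeezes \<open>\<alpha>(I\<^sup>(\<^sup>m\<^sup>)) / m\<close>
  to \<open>\<alpha>(I\<^sup>(\<^sup>2\<^sup>)) / 2\<close>.
\<close>

definition k_cover :: "'v set set \<Rightarrow> nat \<Rightarrow> ('v \<Rightarrow> nat) \<Rightarrow> bool" where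
  "k_cover E m t \<longleftrightarrow> (\<forall>e\<in>E. m \<le> sum t e)"

text \<open>The \<open>m\<close>-th power of the ideal generated by the variables in \<open>e\<close>, described through
  exponent vectors.\<close>

definition order_ideal :: "'v set \<Rightarrow> nat \<Rightarrow> ('v, 'k::field) mpoly set" where
  "order_ideal e m = {f. \<forall>t\<in>Poly_Mapping.keys f. m \<le> sum (Poly_Mapping.lookup t) e}"

lemma gen_ideal_subset_order_ideal:
  assumes "B \<subseteq> order_ideal e m"
  shows "gen_ideal B \<subseteq> order_ideal e m"
proof -
  interpret module "(*) :: ('a, 'b) mpoly \<Rightarrow> ('a, 'b) mpoly \<Rightarrow> ('a, 'b) mpoly"
    by (rule module_mult)
  have "subspace (order_ideal e m :: ('a, 'b) mpoly set)"
  proof (rule subspaceI)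
    show "0 \<in> (order_ideal e m :: ('a, 'b) mpoly set)"
      by (simp add: order_ideal_def)
  next
    fix f g :: "('a, 'b) mpoly"
    assume "f \<in> order_ideal e m" "g \<in> order_ideal e m"
    then show "f + g \<in> order_ideal e m"
      using Poly_Mapping.keys_add[of f g] by (auto simp: order_ideal_def)
  next
    fix c f :: "('a, 'b) mpoly"
    assume f: "f \<in> order_ideal e m"
    have "m \<le> sum (Poly_Mapping.lookup t) e" if t: "t \<in> Poly_Mapping.keys (c * f)" for t
    proof -
      obtain a b where "t = a + b" "b \<in> Poly_Mapping.keys f"
        using t keys_mult[of c f] by blast
      then show ?thesis
        using f by (auto simp: order_ideal_def lookup_add sum.distrib intro: trans_le_add2)
    qed
    then show "c * f \<in> order_ideal e m"
      by (simp add: order_ideal_def)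
  qed
  then show ?thesis
    unfolding gen_ideal_def using assms by (rule span_minimal[rotated])
qed

lemma order_ideal_mult:
  assumes "f \<in> order_ideal e l" "g \<in> order_ideal e m"
  shows "f * g \<in> order_ideal e (l + m)"
proof -
  have "l + m \<le> sum (Poly_Mapping.lookup t) e" if t: "t \<in> Poly_Mapping.keys (f * g)" for t
  proof -
    obtain a b where "t = a + b" "a \<in> Poly_Mapping.keys f" "b \<in> Poly_Mapping.keys g"
      using t keys_mult[of f g] by blast
    then show ?thesis
      using assms by (auto simp: order_ideal_def lookup_add sum.distrib intro: add_mono)
  qed
  then show ?thesis
    by (simp add: order_ideal_def)
qed

lemma ideal_power_subset_order_ideal:
  fixes e :: "'v::finite set"
  shows "ideal_power (gen_ideal (var ` e)) m \<subseteq> (order_ideal e m :: ('v, 'k::field) mpoly set)"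
proof (induction m)
  case 0
  show ?case by (simp add: order_ideal_def)
next
  case (Suc m)
  have "(var v :: ('v, 'k) mpoly) \<in> order_ideal e 1" if "v \<in> e" for v
    using that by (simp add: order_ideal_def var_def lookup_single when_def)
  then have "gen_ideal (var ` e) \<subseteq> (order_ideal e 1 :: ('v, 'k) mpoly set)"
    by (intro gen_ideal_subset_order_ideal) auto
  then have "{a * b |a b. a \<in> gen_ideal (var ` e) \<and> b \<in> ideal_power (gen_ideal (var ` e)) m}
      \<subseteq> (order_ideal e (1 + m) :: ('v, 'k) mpoly set)"
    using Suc.IH by (blast intro: order_ideal_mult)
  then show ?case
    by (simp add: ideal_mult_def gen_ideal_subset_order_ideal)
qed

text \<open>For monomials the preceding inclusion can be reversed: a monomial of order at least \<open>m + 1\<close>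
  along \<open>e\<close> is divisible by a variable in \<open>e\<close>, and splitting that variable off lowers the order
  by one.\<close>

lemma monomial_in_ideal_power:
  fixes e :: "'v::finite set"
  assumes "m \<le> sum (Poly_Mapping.lookup t) e"
  shows "(Poly_Mapping.single t 1 :: ('v, 'k::field) mpoly)
    \<in> ideal_power (gen_ideal (var ` e)) m"
  using assms
proof (induction m arbitrary: t)
  case 0
  show ?case by simp
next
  case (Suc m)
  interpret module "(*) :: ('v, 'k) mpoly \<Rightarrow> ('v, 'k) mpoly \<Rightarrow> ('v, 'k) mpoly"
    by (rule module_mult)
  obtain v where v: "v \<in> e" "Poly_Mapping.lookup t v \<noteq> 0"
    using Suc.prems by (metis not_less_eq_eq le0 sum.neutral)
  define s where "s = t - Poly_Mapping.single v 1"
  have t: "t = Poly_Mapping.single v 1 + s"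
    using v by (intro poly_mapping_eqI)
      (auto simp: s_def lookup_add lookup_minus lookup_single when_def)
  have "sum (Poly_Mapping.lookup (Poly_Mapping.single v (1::nat))) e = 1"
    using v by (simp add: lookup_single when_def)
  then have "m \<le> sum (Poly_Mapping.lookup s) e"
    using Suc.prems by (simp add: t lookup_add sum.distrib)
  then have "(Poly_Mapping.single s 1 :: ('v, 'k) mpoly) \<in> ideal_power (gen_ideal (var ` e)) m"
    by (rule Suc.IH)
  moreover have "(var v :: ('v, 'k) mpoly) \<in> gen_ideal (var ` e)"
    unfolding gen_ideal_def using v by (blast intro: span_base)
  moreover have "(Poly_Mapping.single t 1 :: ('v, 'k) mpoly) = var v * Poly_Mapping.single s 1"
    by (simp add: t var_def mult_single)
  ultimately show ?case
    by (auto simp: ideal_mult_def gen_ideal_def intro!: span_base)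
qed

lemma k_cover_keys_symbolic_power:
  assumes "f \<in> cover_ideal_symbolic_power E m" "t \<in> Poly_Mapping.keys f"
  shows "k_cover E m (Poly_Mapping.lookup t)"
  unfolding k_cover_def
proof
  fix e assume "e \<in> E"
  then have "f \<in> order_ideal e m"
    using assms(1) ideal_power_subset_order_ideal
    by (auto simp: cover_ideal_symbolic_power_def)
  then show "m \<le> sum (Poly_Mapping.lookup t) e"
    using assms(2) by (simp add: order_ideal_def)
qed

lemma initial_degree_le_k_cover:
  fixes E :: "'v::finite set set"
  assumes "k_cover E m t"
  shows "initial_degree (cover_ideal_symbolic_power E m :: ('v, 'k::field) mpoly set) \<le> sum t UNIV"
proof -
  define T where "T = Abs_poly_mapping t"
  have T: "Poly_Mapping.lookup T = t"
    by (simp add: T_def)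
  define f where "f = (Poly_Mapping.single T 1 :: ('v, 'k) mpoly)"
  have "f \<in> cover_ideal_symbolic_power E m"
    using assms monomial_in_ideal_power[of m T]
    by (auto simp: cover_ideal_symbolic_power_def f_def k_cover_def T)
  moreover have "f \<noteq> 0"
    by (metis f_def lookup_single_eq lookup_zero zero_neq_one)
  moreover have "total_degree f = sum t UNIV"
    by (simp add: total_degree_def f_def T)
  ultimately show ?thesis
    unfolding initial_degree_def by (intro Least_le) auto
qed

text \<open>The minimum is attained at any exponent vector of a polynomial of least degree in
  \<open>I\<^sup>(\<^sup>m\<^sup>)\<close>: it is an \<open>m\<close>-cover, so its weight cannot be smaller than the least degree either.\<close>

lemma ex_k_cover_initial_degree:
  fixes E :: "'v::finite set set"
  assumes "simple_graph E"
  shows "\<exists>t. k_cover E m t \<and>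
    sum t UNIV = initial_degree (cover_ideal_symbolic_power E m :: ('v, 'k::field) mpoly set)"
proof -
  let ?S = "cover_ideal_symbolic_power E m :: ('v, 'k) mpoly set"
  \<comment> \<open>The constant weighting \<open>m\<close> shows that the symbolic power contains a nonzero polynomial.\<close>
  define T where "T = (Abs_poly_mapping (\<lambda>_. m) :: 'v \<Rightarrow>\<^sub>0 nat)"
  have T: "Poly_Mapping.lookup T = (\<lambda>_. m)"
    by (simp add: T_def)
  have "m \<le> sum (Poly_Mapping.lookup T) e" if "e \<in> E" for e
    using that assms by (simp add: T simple_graph_def)
  then have "Poly_Mapping.single T 1 \<in> ?S"
    using monomial_in_ideal_power[of m T] by (auto simp: cover_ideal_symbolic_power_def)
  moreover have "(Poly_Mapping.single T 1 :: ('v, 'k) mpoly) \<noteq> 0"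
    by (metis lookup_single_eq lookup_zero zero_neq_one)
  ultimately have "\<exists>d. \<exists>f\<in>?S. f \<noteq> 0 \<and> d = total_degree f"
    by blast
  from LeastI_ex[OF this] obtain f where f: "f \<in> ?S" "f \<noteq> 0" "initial_degree ?S = total_degree f"
    unfolding initial_degree_def by blast
  then obtain t where t: "t \<in> Poly_Mapping.keys f"
    by (metis all_not_in_conv keys_eq_empty)
  then have "k_cover E m (Poly_Mapping.lookup t)"
    using f k_cover_keys_symbolic_power by blast
  moreover have "sum (Poly_Mapping.lookup t) UNIV \<le> total_degree f"
    unfolding total_degree_def using t by (intro Max_ge) auto
  ultimately show ?thesis
    using f initial_degree_le_k_cover by (metis le_antisym)
qed

definition rounded :: "nat \<Rightarrow> nat \<Rightarrow> ('v \<Rightarrow> nat) \<Rightarrow> 'v \<Rightarrow> nat" where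
  "rounded m \<theta> t v = of_bool (\<theta> \<le> 2 * t v) + of_bool (2 * m + 1 - \<theta> \<le> 2 * t v)"

text \<open>If an end of an edge misses the threshold \<open>\<theta>\<close>, then the other end, carrying the rest of the
  weight \<open>2 m\<close>, passes the complementary threshold \<open>2 m + 1 - \<theta>\<close>. Since that threshold is the
  larger one, the other end receives both units.\<close>

lemma k_cover_rounded:
  assumes "simple_graph E" "k_cover E m t" "\<theta> \<in> {1..m}"
  shows "k_cover E 2 (rounded m \<theta> t)"
  unfolding k_cover_def
proof
  fix e assume e: "e \<in> E"
  then obtain i j where ij: "e = {i, j}" "i \<noteq> j"
    using assms(1) by (auto simp: simple_graph_def card_2_iff)
  then have "m \<le> t i + t j"
    using assms(2) e by (auto simp: k_cover_def)
  then have "2 \<le> rounded m \<theta> t i + rounded m \<theta> t j"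
    using assms(3) by (auto simp: rounded_def of_bool_def)
  then show "2 \<le> sum (rounded m \<theta> t) e"
    using ij by simp
qed

lemma sum_rounded_le: "(\<Sum>\<theta>\<in>{1..m}. rounded m \<theta> t v) \<le> 2 * t v"
proof -
  let ?c = "2 * t v"
  \<comment> \<open>Reflection carries the complementary thresholds onto \<open>{m+1..2m}\<close>.\<close>
  have "(\<Sum>\<theta>\<in>{1..m}. of_bool (2 * m + 1 - \<theta> \<le> ?c)) = (\<Sum>\<theta>\<in>{m+1..2*m}. of_bool (\<theta> \<le> ?c) :: nat)"
    by (rule sum.reindex_bij_witness[of _ "\<lambda>\<theta>. 2 * m + 1 - \<theta>" "\<lambda>\<theta>. 2 * m + 1 - \<theta>"]) auto
  then have "(\<Sum>\<theta>\<in>{1..m}. rounded m \<theta> t v)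
      = (\<Sum>\<theta>\<in>{1..m}. of_bool (\<theta> \<le> ?c)) + (\<Sum>\<theta>\<in>{m+1..2*m}. of_bool (\<theta> \<le> ?c))"
    by (simp add: rounded_def sum.distrib)
  also have "\<dots> = (\<Sum>\<theta>\<in>{1..m} \<union> {m+1..2*m}. of_bool (\<theta> \<le> ?c))"
    by (subst sum.union_disjoint) auto
  also have "\<dots> = card (({1..m} \<union> {m+1..2*m}) \<inter> {\<theta>. \<theta> \<le> ?c})"
    by (simp add: sum_of_bool_eq Int_def)
  also have "\<dots> \<le> card {1..?c}"
    by (rule card_mono) auto
  finally show ?thesis by simp
qed

text \<open>The least weight of a \<open>2\<close>-cover is at most the average weight of the \<open>m\<close> rounded covers.\<close>

lemma initial_degree_lower_bound:
  fixes E :: "'v::finite set set"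
  defines "a \<equiv> \<lambda>m. initial_degree (cover_ideal_symbolic_power E m :: ('v, 'k::field) mpoly set)"
  assumes "simple_graph E"
  shows "m * a 2 \<le> 2 * a m"
proof -
  obtain t where t: "k_cover E m t" "sum t UNIV = a m"
    using ex_k_cover_initial_degree[OF assms(2), where 'k = 'k] unfolding a_def by metis
  have "m * a 2 = (\<Sum>\<theta>\<in>{1..m}. a 2)"
    by simp
  also have "\<dots> \<le> (\<Sum>\<theta>\<in>{1..m}. sum (rounded m \<theta> t) UNIV)"
    unfolding a_def
    by (intro sum_mono initial_degree_le_k_cover k_cover_rounded[OF assms(2) t(1)])
  also have "\<dots> = (\<Sum>v\<in>UNIV. \<Sum>\<theta>\<in>{1..m}. rounded m \<theta> t v)"
    by (rule sum.swap)
  also have "\<dots> \<le> (\<Sum>v\<in>UNIV. 2 * t v)"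
    by (intro sum_mono sum_rounded_le)
  also have "\<dots> = 2 * a m"
    by (simp add: t(2) flip: sum_distrib_left)
  finally show ?thesis .
qed

lemma initial_degree_upper_bound:
  fixes E :: "'v::finite set set"
  defines "a \<equiv> \<lambda>m. initial_degree (cover_ideal_symbolic_power E m :: ('v, 'k::field) mpoly set)"
  assumes "simple_graph E"
  shows "2 * a m \<le> (m + 1) * a 2"
proof -
  obtain t where t: "k_cover E 2 t" "sum t UNIV = a 2"
    using ex_k_cover_initial_degree[OF assms(2), where 'k = 'k] unfolding a_def by metis
  define k where "k = (m + 1) div 2"
  have k: "m \<le> 2 * k" "2 * k \<le> m + 1"
    by (auto simp: k_def)
  have "k_cover E m (\<lambda>v. k * t v)"
    unfolding k_cover_def
  proof
    fix e assume "e \<in> E"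
    then have "2 \<le> sum t e"
      using t(1) by (simp add: k_cover_def)
    then have "2 * k \<le> sum t e * k"
      by (rule mult_le_mono1)
    then have "m \<le> k * sum t e"
      using k(1) by (simp only: mult.commute[of k])
    then show "m \<le> (\<Sum>v\<in>e. k * t v)"
      by (simp only: sum_distrib_left)
  qed
  then have "a m \<le> (\<Sum>v\<in>UNIV. k * t v)"
    unfolding a_def by (rule initial_degree_le_k_cover)
  then have "2 * a m \<le> (2 * k) * a 2"
    by (simp add: t(2) flip: sum_distrib_left)
  also have "\<dots> \<le> (m + 1) * a 2"
    using k(2) by (rule mult_le_mono1)
  finally show ?thesis .
qed

theorem corollary4p4:
  fixes E :: "'v::finite set set"
    and symb :: "nat \<Rightarrow> ('v, 'k::field) mpoly set"
  defines "symb \<equiv> cover_ideal_symbolic_power E"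
  assumes "simple_graph E"
  shows "convergent (\<lambda>m. real (initial_degree (symb m)) / real m) \<and>
         waldschmidt_constant symb = real (initial_degree (symb 2)) / 2"
proof -
  define a where "a m = initial_degree (symb m)" for m
  have lower: "a 2 / 2 \<le> a m / m" and upper: "a m / m \<le> a 2 / 2 + a 2 / 2 * (1 / m)"
    if "m > 0" for m :: nat
  proof -
    have "real (m * a 2) \<le> real (2 * a m)" "real (2 * a m) \<le> real ((m + 1) * a 2)"
      using initial_degree_lower_bound[OF assms(2), where 'k = 'k]
        initial_degree_upper_bound[OF assms(2), where 'k = 'k]
      unfolding a_def symb_def of_nat_le_iff by blast+
    then show "a 2 / 2 \<le> a m / m" "a m / m \<le> a 2 / 2 + a 2 / 2 * (1 / m)"
      using that by (simp_all add: field_simps)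
  qed
  have "(\<lambda>m. a 2 / 2 + a 2 / 2 * (1 / real m)) \<longlonglongrightarrow> a 2 / 2 + a 2 / 2 * 0"
    by (intro tendsto_intros lim_1_over_n)
  then have limit: "(\<lambda>m. a 2 / 2 + a 2 / 2 * (1 / real m)) \<longlonglongrightarrow> a 2 / 2"
    by simp
  have "\<forall>\<^sub>F m in sequentially. a 2 / 2 \<le> a m / m"
    "\<forall>\<^sub>F m in sequentially. a m / m \<le> a 2 / 2 + a 2 / 2 * (1 / m)"
    using lower upper by (auto intro!: eventually_sequentiallyI[of 1])
  then have "(\<lambda>m. real (a m) / real m) \<longlonglongrightarrow> a 2 / 2"
    by (rule tendsto_sandwich[OF _ _ tendsto_const limit])
  then show ?thesis
    unfolding waldschmidt_constant_def a_def by (auto simp: convergent_def limI)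
qed

end
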